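(* Let $V$ be a finite-dimensional real vector space. Then $\varepsilon(V[1])$ is isomorphic to the omni-Lie algebra $gl(V)\oplus V$; that is, there is an $\mathbb{R}$-linear isomorphism $\varepsilon(V[1])\cong gl(V)\oplus V$ under which the induced Courant bracket on $\varepsilon(V[1])$ corresponds to Weinstein's bracket $[\![(\xi_1,v_1),(\xi_2,v_2)]\!]=([\xi_1,\xi_2],\xi_1(v_2))$ on $gl(V)\oplus V$.
   Context: $V[1]:=V\oplus\mathbb{R}\cdot1$ is the unital commutative $\mathbb{R}$-algebra with unit $1$ and $v_1\cdot v_2=0$ for all $v_1,v_2\in V$. $gl(V)$ is the Lie algebra of all linear endomorphisms of $V$ with the commutator bracket. The omni-Lie algebra of $V$ is $gl(V)\oplus V$ with Weinstein's (Leibniz) bracket $[\![(\xi_1,v_1),(\xi_2,v_2)]\!]=([\xi_1,\xi_2],\xi_1(v_2))$. For a unital commutative $k$-algebra $\mathcal{A}$, let $\mathrm{Der}(\mathcal{A})$ be the $k$-linear derivations of $\mathcal{A}$ (this is the first Hochschild cohomology $H^1(\mathcal{A},\mathcal{A})$) and $\Omega^1_{\mathcal{A}|k}$ the module of Kähler differentials with universal derivation $d$ (this is the first Hochschild homology $H_1(\mathcal{A},\mathcal{A})$, via $a_0\otimes a_1\leftrightarrow a_0\,da_1$). Put $E(\mathcal{A})=\mathrm{Der}(\mathcal{A})\oplus\Omega^1_{\mathcal{A}|k}$, with pairing $\langle X,a\,db\rangle=aX(b)\in\mathcal{A}$, Lie derivative $\mathcal{L}_X(a\,db)=X(a)\,db+a\,d(X(b))$,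 Courant bracket $[\![(X_1,\alpha_1),(X_2,\alpha_2)]\!]=([X_1,X_2],\mathcal{L}_{X_1}\alpha_2-\mathcal{L}_{X_2}\alpha_1+d\langle X_2,\alpha_1\rangle)$, and symmetric bilinear form $((X_1,\alpha_1),(X_2,\alpha_2))=\langle X_2,\alpha_1\rangle+\langle X_1,\alpha_2\rangle$. Let $J=\{e\in E(\mathcal{A}):(e,e')=0\ \forall e'\in E(\mathcal{A})\}$, an ideal for the Courant bracket, and $\varepsilon(\mathcal{A})=E(\mathcal{A})/J$ with the induced Courant bracket. Here $k=\mathbb{R}$ and $\mathcal{A}=V[1]$. *)

theory Defs
  imports "HOL-Library.Poly_Mapping" "HOL-Analysis.Product_Vector"
begin

section \<open>Derivations of a commutative real algebra\<close>

text \<open>A unital commutative real algebra is a type of sort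
  \<open>{comm_ring_1, real_algebra_1}\<close>.\<close>

typedef (overloaded) 'a derivation =
  "{D :: 'a::{comm_ring_1, real_algebra_1} \<Rightarrow> 'a.
      linear D \<and> (\<forall>a b. D (a * b) = a * D b + b * D a)}"
  morphisms der_apply Derivation
proof
  show "(\<lambda>_. 0) \<in> {D :: 'a \<Rightarrow> 'a. linear D \<and> (\<forall>a b. D (a * b) = a * D b + b * D a)}"
    by (simp add: linear_iff)
qed

setup_lifting type_definition_derivation

instantiation derivation :: ("{comm_ring_1, real_algebra_1}") real_vector
begin

lift_definition zero_derivation :: "'a derivation" is "\<lambda>_. 0"
  by (simp add: linear_iff)

lift_definition plus_derivation :: "'a derivation \<Rightarrow> 'a derivation \<Rightarrow> 'a derivation"
  is "\<lambda>X Y a. X a + Y a"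
  by (auto simp: linear_iff algebra_simps)

lift_definition minus_derivation :: "'a derivation \<Rightarrow> 'a derivation \<Rightarrow> 'a derivation"
  is "\<lambda>X Y a. X a - Y a"
  by (auto simp: linear_iff algebra_simps)

lift_definition uminus_derivation :: "'a derivation \<Rightarrow> 'a derivation"
  is "\<lambda>X a. - X a"
  by (auto simp: linear_iff algebra_simps)

lift_definition scaleR_derivation :: "real \<Rightarrow> 'a derivation \<Rightarrow> 'a derivation"
  is "\<lambda>r X a. r *\<^sub>R X a"
  by (auto simp: linear_iff algebra_simps)

instance
  by standard (transfer; simp add: fun_eq_iff algebra_simps)+

end

lift_definition der_bracket :: "'a::{comm_ring_1, real_algebra_1} derivation \<Rightarrow> 'a derivation \<Rightarrow> 'a derivation"
  is "\<lambda>X Y a. X (Y a) - Y (X a)"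
  by (auto simp: linear_iff algebra_simps)

lemma der_add: "der_apply X (a + b) = der_apply X a + der_apply X b"
  by transfer (simp add: linear_iff)

lemma der_zero [simp]: "der_apply X 0 = 0"
  using der_add[of X 0 0] by simp

lemma der_minus: "der_apply X (- a) = - der_apply X a"
  using der_add[of X a "- a"] by (simp add: eq_neg_iff_add_eq_0 add.commute)

lemma der_diff: "der_apply X (a - b) = der_apply X a - der_apply X b"
  using der_add[of X a "- b"] by (simp add: der_minus)

lemma der_scaleR: "der_apply X (r *\<^sub>R a) = r *\<^sub>R der_apply X a"
  by transfer (simp add: linear_iff)

lemma der_mult: "der_apply X (a * b) = a * der_apply X b + b * der_apply X a"
  by transfer simp

lemma der_one [simp]: "der_apply X 1 = 0"
  using der_mult[of X 1 1] by simp

lemma der_of_real [simp]: "der_apply X (of_real r) = 0"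
  by (simp add: of_real_def der_scaleR)


section \<open>Kaehler differentials\<close>

text \<open>\<open>'a \<Rightarrow>\<^sub>0 'a\<close> is used as the free module over the algebra \<open>'a\<close> on symbols
  \<open>[b]\<close>, one for each \<open>b :: 'a\<close>; \<open>Poly_Mapping.single b a\<close> stands for \<open>a [b]\<close>.
  (The convolution product that \<open>Poly_Mapping\<close> also defines on this type plays no role.)
  The module of Kaehler differentials is its quotient by the submodule generated by the
  relations that make \<open>b \<mapsto> [b]\<close> a real-linear derivation.\<close>

definition kfree_scale :: "'a::comm_ring_1 \<Rightarrow> ('a \<Rightarrow>\<^sub>0 'a) \<Rightarrow> ('a \<Rightarrow>\<^sub>0 'a)"
  where "kfree_scale a p = Poly_Mapping.map ((*) a) p"

lemma lookup_kfree_scale: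
  "Poly_Mapping.lookup (kfree_scale a p) b = a * Poly_Mapping.lookup p b"
  by (simp add: kfree_scale_def Poly_Mapping.map.rep_eq when_def)

lemma kfree_scale_single [simp]:
  "kfree_scale a (Poly_Mapping.single b c) = Poly_Mapping.single b (a * c)"
  by (rule poly_mapping_eqI) (simp add: lookup_kfree_scale lookup_single when_def)

global_interpretation kfree: module "kfree_scale :: 'a::comm_ring_1 \<Rightarrow> _"
  by standard (rule poly_mapping_eqI, simp add: lookup_kfree_scale lookup_add algebra_simps)+

definition kaehler_relations :: "('a::{comm_ring_1, real_algebra_1} \<Rightarrow>\<^sub>0 'a) set"
  where "kaehler_relations =
      {Poly_Mapping.single (a + b) 1 - Poly_Mapping.single a 1 - Poly_Mapping.single b 1 | a b. True}
    \<union> {Poly_Mapping.single (r *\<^sub>R a) 1 - Poly_Mapping.single a (of_real r) | r a. True}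
    \<union> {Poly_Mapping.single (a * b) 1 - Poly_Mapping.single b a - Poly_Mapping.single a b | a b. True}"

quotient_type (overloaded) 'a kaehler = "'a::{comm_ring_1, real_algebra_1} \<Rightarrow>\<^sub>0 'a" /
  "\<lambda>p q. p - q \<in> kfree.span kaehler_relations"
proof (rule equivpI)
  show "reflp (\<lambda>p q :: 'a \<Rightarrow>\<^sub>0 'a. p - q \<in> kfree.span kaehler_relations)"
    by (simp add: reflp_def kfree.span_zero)
  show "symp (\<lambda>p q :: 'a \<Rightarrow>\<^sub>0 'a. p - q \<in> kfree.span kaehler_relations)"
    by (metis (no_types, lifting) sympI kfree.span_neg minus_diff_eq)
  show "transp (\<lambda>p q :: 'a \<Rightarrow>\<^sub>0 'a. p - q \<in> kfree.span kaehler_relations)"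
    by (rule transpI) (metis (no_types, lifting) kfree.span_add diff_add_cancel add_diff_eq)
qed

instantiation kaehler :: ("{comm_ring_1, real_algebra_1}") ab_group_add
begin

lift_definition zero_kaehler :: "'a kaehler" is 0 .

lift_definition plus_kaehler :: "'a kaehler \<Rightarrow> 'a kaehler \<Rightarrow> 'a kaehler" is "(+)"
  by (metis (no_types, lifting) add_diff_add kfree.span_add)

lift_definition uminus_kaehler :: "'a kaehler \<Rightarrow> 'a kaehler" is uminus
  by (metis (no_types, lifting) minus_diff_minus kfree.span_neg)

definition minus_kaehler :: "'a kaehler \<Rightarrow> 'a kaehler \<Rightarrow> 'a kaehler"
  where "minus_kaehler \<alpha> \<beta> = \<alpha> + - \<beta>"

instance
  by standard (unfold minus_kaehler_def, (transfer; simp add: algebra_simps kfree.span_zero)+)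

end

lift_definition kscale :: "'a::{comm_ring_1, real_algebra_1} \<Rightarrow> 'a kaehler \<Rightarrow> 'a kaehler"
  is kfree_scale
  by (metis (no_types, lifting) kfree.scale_right_diff_distrib kfree.span_scale)

lift_definition kd :: "'a::{comm_ring_1, real_algebra_1} \<Rightarrow> 'a kaehler"
  is "\<lambda>b. Poly_Mapping.single b 1" .

global_interpretation kaehler: module "kscale :: 'a::{comm_ring_1, real_algebra_1} \<Rightarrow> _"
  by standard (transfer; simp add: kfree.scale_right_distrib kfree.scale_left_distrib kfree.span_zero)+

instantiation kaehler :: ("{comm_ring_1, real_algebra_1}") real_vector
begin

definition scaleR_kaehler :: "real \<Rightarrow> 'a kaehler \<Rightarrow> 'a kaehler"
  where "r *\<^sub>R \<alpha> = kscale (of_real r) \<alpha>"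

instance
  by standard (simp_all add: scaleR_kaehler_def kaehler.scale_right_distrib kaehler.scale_left_distrib)

end

lemma kd_add: "kd (a + b) = kd a + kd b"
  by transfer (rule kfree.span_base, auto simp: kaehler_relations_def diff_diff_eq)

lemma kd_scaleR: "kd (r *\<^sub>R a) = r *\<^sub>R kd a"
  unfolding scaleR_kaehler_def
  by transfer (rule kfree.span_base, auto simp: kaehler_relations_def)

lemma kd_mult: "kd (a * b) = kscale a (kd b) + kscale b (kd a)"
  by transfer (rule kfree.span_base, auto simp: kaehler_relations_def diff_diff_eq)

text \<open>Additive maps out of the free module.\<close>

definition kfree_extend :: "('a \<Rightarrow> 'a \<Rightarrow> 'm) \<Rightarrow> ('a::comm_ring_1 \<Rightarrow>\<^sub>0 'a) \<Rightarrow> 'm::ab_group_add"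
  where "kfree_extend f p = (\<Sum>b\<in>Poly_Mapping.keys p. f b (Poly_Mapping.lookup p b))"

lemma kfree_extend_single:
  "f b 0 = 0 \<Longrightarrow> kfree_extend f (Poly_Mapping.single b a) = f b a"
  by (simp add: kfree_extend_def)

lemma kfree_extend_add:
  assumes "\<And>b. f b 0 = 0" "\<And>b x y. f b (x + y) = f b x + f b y"
  shows "kfree_extend f (p + q) = kfree_extend f p + kfree_extend f q"
  unfolding kfree_extend_def
  by (rule setsum_keys_plus_distrib) (use assms in auto)

lemma kfree_extend_diff:
  assumes "\<And>b. f b 0 = 0" "\<And>b x y. f b (x + y) = f b x + f b y"
  shows "kfree_extend f (p - q) = kfree_extend f p - kfree_extend f q"
  using kfree_extend_add[of f "p - q" q, OF assms] by (simp add: algebra_simps)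

lemma kfree_monomials:
  "(\<Sum>k\<in>Poly_Mapping.keys p. Poly_Mapping.single k (Poly_Mapping.lookup p k)) = p"
  by (rule poly_mapping_eqI)
     (simp add: lookup_sum lookup_single when_def in_keys_iff)

lemma kfree_induct [case_names single add]:
  assumes "\<And>a b. P (Poly_Mapping.single b a)"
    and "\<And>p q. P p \<Longrightarrow> P q \<Longrightarrow> P (p + q)"
  shows "P (p :: 'a::comm_ring_1 \<Rightarrow>\<^sub>0 'a)"
proof -
  have "P 0"
    using assms(1)[of 0 0] by simp
  have "P (\<Sum>k\<in>A. Poly_Mapping.single k (Poly_Mapping.lookup p k))" if "finite A" for A
    using that by induction (auto simp: \<open>P 0\<close> assms)
  then have "P (\<Sum>k\<in>Poly_Mapping.keys p. Poly_Mapping.single k (Poly_Mapping.lookup p k))"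
    by simp
  then show ?thesis
    by (simp only: kfree_monomials)
qed

definition kfree_pairing :: "'a::{comm_ring_1, real_algebra_1} derivation \<Rightarrow> ('a \<Rightarrow>\<^sub>0 'a) \<Rightarrow> 'a"
  where "kfree_pairing X = kfree_extend (\<lambda>b a. a * der_apply X b)"

lemma kfree_pairing_single:
  "kfree_pairing X (Poly_Mapping.single b a) = a * der_apply X b"
  by (simp add: kfree_pairing_def kfree_extend_single)

lemma kfree_pairing_add: "kfree_pairing X (p + q) = kfree_pairing X p + kfree_pairing X q"
  by (simp add: kfree_pairing_def kfree_extend_add algebra_simps)

lemma kfree_pairing_diff: "kfree_pairing X (p - q) = kfree_pairing X p - kfree_pairing X q"
  by (simp add: kfree_pairing_def kfree_extend_diff algebra_simps)

lemma kfree_pairing_scale: "kfree_pairing X (kfree_scale a p) = a * kfree_pairing X p"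
  by (induction p rule: kfree_induct)
     (simp_all add: kfree_pairing_single kfree_pairing_add kfree.scale_right_distrib algebra_simps)

lemma kfree_pairing_span:
  assumes "p \<in> kfree.span kaehler_relations"
  shows "kfree_pairing X p = 0"
  using assms
proof (induction rule: kfree.span_induct_alt)
  case base
  then show ?case
    using kfree_pairing_single[of X 0 0] by simp
next
  case (step c x y)
  have "kfree_pairing X x = 0"
    using step(1) unfolding kaehler_relations_def
    by (auto simp: kfree_pairing_diff kfree_pairing_single der_add der_mult der_scaleR
        scaleR_conv_of_real)
  with step show ?case
    by (simp add: kfree_pairing_add kfree_pairing_scale)
qed

lift_definition pairing :: "'a::{comm_ring_1, real_algebra_1} derivation \<Rightarrow> 'a kaehler \<Rightarrow> 'a"
  is kfree_pairing
  subgoal for X p q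
    using kfree_pairing_span[of "p - q" X] by (simp add: kfree_pairing_diff)
  done

definition kfree_lie :: "'a::{comm_ring_1, real_algebra_1} derivation \<Rightarrow> ('a \<Rightarrow>\<^sub>0 'a) \<Rightarrow> ('a \<Rightarrow>\<^sub>0 'a)"
  where "kfree_lie X = kfree_extend
    (\<lambda>b a. Poly_Mapping.single b (der_apply X a) + Poly_Mapping.single (der_apply X b) a)"

lemma kfree_lie_single:
  "kfree_lie X (Poly_Mapping.single b a) =
    Poly_Mapping.single b (der_apply X a) + Poly_Mapping.single (der_apply X b) a"
  by (simp add: kfree_lie_def kfree_extend_single)

lemma kfree_lie_add: "kfree_lie X (p + q) = kfree_lie X p + kfree_lie X q"
  by (simp add: kfree_lie_def kfree_extend_add der_add single_add algebra_simps)

lemma kfree_lie_diff: "kfree_lie X (p - q) = kfree_lie X p - kfree_lie X q"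
  using kfree_lie_add[of X "p - q" q] by (simp add: algebra_simps)

lemma kfree_lie_scale:
  "kfree_lie X (kfree_scale a p) = kfree_scale (der_apply X a) p + kfree_scale a (kfree_lie X p)"
  by (induction p rule: kfree_induct)
     (simp_all add: kfree_lie_single kfree_lie_add kfree.scale_right_distrib der_mult single_add
        algebra_simps)

lemma abs_kaehler_eq_0_iff: "abs_kaehler p = 0 \<longleftrightarrow> p \<in> kfree.span kaehler_relations"
  by (simp add: zero_kaehler_def kaehler.abs_eq_iff)

lemma abs_kaehler_add: "abs_kaehler (p + q) = abs_kaehler p + abs_kaehler q"
  by (simp add: plus_kaehler.abs_eq)

lemma abs_kaehler_diff: "abs_kaehler (p - q) = abs_kaehler p - abs_kaehler q"
  using abs_kaehler_add[of "p - q" q] by (simp add: algebra_simps)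

lemma abs_kaehler_single: "abs_kaehler (Poly_Mapping.single b a) = kscale a (kd b)"
  by (simp add: kd.abs_eq kscale.abs_eq)

lemma kfree_lie_span:
  assumes "p \<in> kfree.span kaehler_relations"
  shows "kfree_lie X p \<in> kfree.span kaehler_relations"
  using assms
proof (induction rule: kfree.span_induct_alt)
  case base
  then show ?case
    using kfree_lie_single[of X 0 0] by (simp add: kfree.span_zero)
next
  case (step c x y)
  consider
      (add) a b where "x = Poly_Mapping.single (a + b) 1 - Poly_Mapping.single a 1 - Poly_Mapping.single b 1"
    | (scale) r a where "x = Poly_Mapping.single (r *\<^sub>R a) 1 - Poly_Mapping.single a (of_real r)"
    | (mult) a b where "x = Poly_Mapping.single (a * b) 1 - Poly_Mapping.single b a - Poly_Mapping.single a b"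
    using step(1) unfolding kaehler_relations_def by blast
  then have "abs_kaehler (kfree_lie X x) = 0"
  proof cases
    case add
    then show ?thesis
      by (simp add: kfree_lie_diff kfree_lie_single abs_kaehler_diff abs_kaehler_add
          abs_kaehler_single der_add kd_add)
  next
    case scale
    then show ?thesis
      by (simp add: kfree_lie_diff kfree_lie_single abs_kaehler_diff abs_kaehler_add
          abs_kaehler_single der_scaleR kd_scaleR scaleR_kaehler_def)
  next
    case mult
    then show ?thesis
      by (simp add: kfree_lie_diff kfree_lie_single abs_kaehler_diff abs_kaehler_add
          abs_kaehler_single der_mult kd_mult kd_add)
  qed
  then have "kfree_lie X x \<in> kfree.span kaehler_relations"
    by (simp add: abs_kaehler_eq_0_iff)
  then show ?case
    using step
    by (simp add: kfree_lie_add kfree_lie_scale kfree.span_add kfree.span_scale kfree.span_base)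
qed

lift_definition lie_derivative ::
    "'a::{comm_ring_1, real_algebra_1} derivation \<Rightarrow> 'a kaehler \<Rightarrow> 'a kaehler"
  is kfree_lie
  subgoal for X p q
    using kfree_lie_span[of "p - q" X] by (simp add: kfree_lie_diff)
  done

text \<open>The defining formulas of the pairing and of the Lie derivative.\<close>

lemma pairing_kscale_kd: "pairing X (kscale a (kd b)) = a * der_apply X b"
  by transfer (simp add: kfree_pairing_single)

lemma lie_derivative_kscale_kd:
  "lie_derivative X (kscale a (kd b)) = kscale (der_apply X a) (kd b) + kscale a (kd (der_apply X b))"
  by (simp flip: abs_kaehler_single abs_kaehler_add add: lie_derivative.abs_eq kfree_lie_single)

lemma pairing_add: "pairing X (\<alpha> + \<beta>) = pairing X \<alpha> + pairing X \<beta>"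
  by transfer (rule kfree_pairing_add)

lemma lie_derivative_add: "lie_derivative X (\<alpha> + \<beta>) = lie_derivative X \<alpha> + lie_derivative X \<beta>"
  by (induct \<alpha>; induct \<beta>)
     (simp flip: abs_kaehler_add add: lie_derivative.abs_eq kfree_lie_add)

lemma kaehler_induct [case_names gen add]:
  assumes "\<And>a b. P (kscale a (kd b))"
    and "\<And>\<alpha> \<beta>. P \<alpha> \<Longrightarrow> P \<beta> \<Longrightarrow> P (\<alpha> + \<beta>)"
  shows "P \<alpha>"
proof -
  have "P (abs_kaehler p)" for p
    by (induction p rule: kfree_induct)
       (simp_all add: abs_kaehler_single abs_kaehler_add assms)
  then show ?thesis
    by (induct \<alpha>)
qed


section \<open>The Courant bracket and the quotient by the kernel of the bilinear form\<close>

definition courant_bracket ::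
    "'a::{comm_ring_1, real_algebra_1} derivation \<times> 'a kaehler \<Rightarrow> 'a derivation \<times> 'a kaehler
      \<Rightarrow> 'a derivation \<times> 'a kaehler"
  where "courant_bracket = (\<lambda>(X1, \<alpha>1) (X2, \<alpha>2).
    (der_bracket X1 X2,
     lie_derivative X1 \<alpha>2 - lie_derivative X2 \<alpha>1 + kd (pairing X2 \<alpha>1)))"

definition courant_form ::
    "'a::{comm_ring_1, real_algebra_1} derivation \<times> 'a kaehler \<Rightarrow> 'a derivation \<times> 'a kaehler \<Rightarrow> 'a"
  where "courant_form = (\<lambda>(X1, \<alpha>1) (X2, \<alpha>2). pairing X2 \<alpha>1 + pairing X1 \<alpha>2)"

definition courant_kernel :: "('a::{comm_ring_1, real_algebra_1} derivation \<times> 'a kaehler) set"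
  where "courant_kernel = {e. \<forall>e'. courant_form e e' = 0}"

lemma der_bracket_apply:
  "der_apply (der_bracket X Y) a = der_apply X (der_apply Y a) - der_apply Y (der_apply X a)"
  by transfer simp

lemma pairing_zero [simp]: "pairing X 0 = 0"
  using pairing_add[of X 0 0] by simp

lemma pairing_diff: "pairing X (\<alpha> - \<beta>) = pairing X \<alpha> - pairing X \<beta>"
  using pairing_add[of X "\<alpha> - \<beta>" \<beta>] by (simp add: algebra_simps)

lemma lie_derivative_diff: "lie_derivative X (\<alpha> - \<beta>) = lie_derivative X \<alpha> - lie_derivative X \<beta>"
  using lie_derivative_add[of X "\<alpha> - \<beta>" \<beta>] by (simp add: algebra_simps)

lemma kd_diff: "kd (a - b) = kd a - kd b"
  using kd_add[of "a - b" b] by (simp add: algebra_simps)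

lemma kd_zero [simp]: "kd 0 = 0"
  using kd_diff[of 0 0] by simp

lemma pairing_kscale: "pairing X (kscale a \<alpha>) = a * pairing X \<alpha>"
  by (induction \<alpha> rule: kaehler_induct)
     (simp_all add: pairing_kscale_kd pairing_add kaehler.scale_right_distrib algebra_simps)

lemma pairing_zero_left [simp]: "pairing 0 \<alpha> = 0"
  by (induction \<alpha> rule: kaehler_induct)
     (simp_all add: pairing_kscale_kd pairing_add zero_derivation.rep_eq)

lemma pairing_lie_derivative:
  "pairing Y (lie_derivative X \<alpha>) = der_apply X (pairing Y \<alpha>) - pairing (der_bracket X Y) \<alpha>"
  by (induction \<alpha> rule: kaehler_induct)
     (simp_all add: lie_derivative_kscale_kd lie_derivative_add pairing_kscale_kd pairing_add
        der_add der_mult der_bracket_apply algebra_simps)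

lemma courant_kernel_iff:
  "(X, \<alpha>) \<in> courant_kernel \<longleftrightarrow> X = 0 \<and> (\<forall>Y. pairing Y \<alpha> = 0)"
proof
  assume "(X, \<alpha>) \<in> courant_kernel"
  then have *: "pairing Y \<alpha> + pairing X \<beta> = 0" for Y \<beta>
    by (auto simp: courant_kernel_def courant_form_def)
  have "der_apply X b = 0" for b
    using *[of 0 "kscale 1 (kd b)"] by (simp only: pairing_kscale_kd) simp
  then have "X = 0"
    by (simp add: der_apply_inject[symmetric] zero_derivation.rep_eq fun_eq_iff)
  moreover have "pairing Y \<alpha> = 0" for Y
    using *[of Y 0] by simp
  ultimately show "X = 0 \<and> (\<forall>Y. pairing Y \<alpha> = 0)"
    by simp
qed (auto simp: courant_kernel_def courant_form_def)

lemma subspace_courant_kernel: "subspace courant_kernel"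
proof (rule subspaceI)
  show "0 \<in> courant_kernel"
    by (simp add: zero_prod_def courant_kernel_iff)
  show "x + y \<in> courant_kernel" if "x \<in> courant_kernel" "y \<in> courant_kernel" for x y
    using that by (cases x; cases y) (auto simp: courant_kernel_iff pairing_add)
  show "r *\<^sub>R x \<in> courant_kernel" if "x \<in> courant_kernel" for r x
    using that by (cases x) (auto simp: courant_kernel_iff scaleR_kaehler_def pairing_kscale)
qed

quotient_type (overloaded) 'a eps =
  "'a::{comm_ring_1, real_algebra_1} derivation \<times> 'a kaehler" /
  "\<lambda>e e'. e - e' \<in> courant_kernel"
proof (rule equivpI)
  show "reflp (\<lambda>e e'. e - e' \<in> courant_kernel)"
    by (simp add: reflp_def subspace_0[OF subspace_courant_kernel])
  show "symp (\<lambda>e e'. e - e' \<in> courant_kernel)"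
    by (metis (no_types, lifting) sympI subspace_neg[OF subspace_courant_kernel] minus_diff_eq)
  show "transp (\<lambda>e e'. e - e' \<in> courant_kernel)"
    by (rule transpI) (metis (no_types, lifting) subspace_add[OF subspace_courant_kernel]
        diff_add_cancel add_diff_eq)
qed

instantiation eps :: ("{comm_ring_1, real_algebra_1}") real_vector
begin

lift_definition zero_eps :: "'a eps" is 0 .

lift_definition plus_eps :: "'a eps \<Rightarrow> 'a eps \<Rightarrow> 'a eps" is "(+)"
  by (metis (no_types, lifting) add_diff_add subspace_add[OF subspace_courant_kernel])

lift_definition uminus_eps :: "'a eps \<Rightarrow> 'a eps" is uminus
  by (metis (no_types, lifting) minus_diff_minus subspace_neg[OF subspace_courant_kernel])

definition minus_eps :: "'a eps \<Rightarrow> 'a eps \<Rightarrow> 'a eps"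
  where "minus_eps x y = x + - y"

lift_definition scaleR_eps :: "real \<Rightarrow> 'a eps \<Rightarrow> 'a eps" is "(*\<^sub>R)"
  by (metis (no_types, lifting) scaleR_right_diff_distrib subspace_scale[OF subspace_courant_kernel])

instance
  by standard (unfold minus_eps_def,
    (transfer; simp add: algebra_simps subspace_0[OF subspace_courant_kernel])+)

end

lift_definition eps_bracket ::
    "'a::{comm_ring_1, real_algebra_1} eps \<Rightarrow> 'a eps \<Rightarrow> 'a eps"
  is courant_bracket
proof -
  fix e1 e1' e2 e2' :: "'a derivation \<times> 'a kaehler"
  assume 1: "e1 - e1' \<in> courant_kernel" and 2: "e2 - e2' \<in> courant_kernel"
  obtain X1 \<alpha>1 X1' \<alpha>1' X2 \<alpha>2 X2' \<alpha>2'
    where e: "e1 = (X1, \<alpha>1)" "e1' = (X1', \<alpha>1')" "e2 = (X2, \<alpha>2)" "e2' = (X2', \<alpha>2')"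
    by (metis surj_pair)
  have X: "X1' = X1" "X2' = X2"
    using 1 2 by (auto simp: e courant_kernel_iff)
  have p: "pairing Y \<alpha>1 = pairing Y \<alpha>1'" "pairing Y \<alpha>2 = pairing Y \<alpha>2'" for Y
    using 1 2 by (auto simp: e courant_kernel_iff pairing_diff)
  show "courant_bracket e1 e2 - courant_bracket e1' e2' \<in> courant_kernel"
    by (simp add: e X courant_bracket_def courant_kernel_iff pairing_diff pairing_add
        pairing_lie_derivative p)
qed


section \<open>The algebra \<open>V[1]\<close>\<close>

text \<open>\<open>Unitalization v s\<close> stands for \<open>v + s 1\<close>; products of two vectors vanish.\<close>

datatype 'a unitalization = Unitalization (vec_part: 'a) (scal_part: real)

instantiation unitalization :: (real_vector) "{comm_ring_1, real_algebra_1}"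
begin

definition zero_unitalization :: "'a unitalization"
  where "0 = Unitalization 0 0"

definition one_unitalization :: "'a unitalization"
  where "1 = Unitalization 0 1"

definition plus_unitalization :: "'a unitalization \<Rightarrow> 'a unitalization \<Rightarrow> 'a unitalization"
  where "x + y = Unitalization (vec_part x + vec_part y) (scal_part x + scal_part y)"

definition minus_unitalization :: "'a unitalization \<Rightarrow> 'a unitalization \<Rightarrow> 'a unitalization"
  where "x - y = Unitalization (vec_part x - vec_part y) (scal_part x - scal_part y)"

definition uminus_unitalization :: "'a unitalization \<Rightarrow> 'a unitalization"
  where "- x = Unitalization (- vec_part x) (- scal_part x)"

definition scaleR_unitalization :: "real \<Rightarrow> 'a unitalization \<Rightarrow> 'a unitalization"
  where "r *\<^sub>R x = Unitalization (r *\<^sub>R vec_part x) (r * scal_part x)"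

definition times_unitalization :: "'a unitalization \<Rightarrow> 'a unitalization \<Rightarrow> 'a unitalization"
  where "x * y = Unitalization (scal_part y *\<^sub>R vec_part x + scal_part x *\<^sub>R vec_part y)
                   (scal_part x * scal_part y)"

instance
  by standard
    (simp_all add: zero_unitalization_def one_unitalization_def plus_unitalization_def
      minus_unitalization_def uminus_unitalization_def scaleR_unitalization_def
      times_unitalization_def unitalization.expand scaleR_add_left scaleR_add_right algebra_simps)

end


section \<open>The omni-Lie algebra\<close>

typedef (overloaded) 'a gl = "{\<xi> :: 'a::real_vector \<Rightarrow> 'a. linear \<xi>}"
  morphisms gl_apply Gl
proof
  show "(\<lambda>_. 0) \<in> {\<xi> :: 'a \<Rightarrow> 'a. linear \<xi>}"
    by (simp add: linear_iff)
qed

setup_lifting type_definition_gl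

instantiation gl :: (real_vector) real_vector
begin

lift_definition zero_gl :: "'a gl" is "\<lambda>_. 0"
  by (simp add: linear_iff)

lift_definition plus_gl :: "'a gl \<Rightarrow> 'a gl \<Rightarrow> 'a gl" is "\<lambda>\<xi> \<eta> v. \<xi> v + \<eta> v"
  by (auto simp: linear_iff algebra_simps)

lift_definition minus_gl :: "'a gl \<Rightarrow> 'a gl \<Rightarrow> 'a gl" is "\<lambda>\<xi> \<eta> v. \<xi> v - \<eta> v"
  by (auto simp: linear_iff algebra_simps)

lift_definition uminus_gl :: "'a gl \<Rightarrow> 'a gl" is "\<lambda>\<xi> v. - \<xi> v"
  by (auto simp: linear_iff algebra_simps)

lift_definition scaleR_gl :: "real \<Rightarrow> 'a gl \<Rightarrow> 'a gl" is "\<lambda>r \<xi> v. r *\<^sub>R \<xi> v"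
  by (auto simp: linear_iff algebra_simps)

instance
  by standard (transfer; simp add: fun_eq_iff algebra_simps)+

end

lift_definition gl_bracket :: "'a::real_vector gl \<Rightarrow> 'a gl \<Rightarrow> 'a gl"
  is "\<lambda>\<xi> \<eta> v. \<xi> (\<eta> v) - \<eta> (\<xi> v)"
  by (auto simp: linear_iff algebra_simps)

definition omni_bracket :: "'a::real_vector gl \<times> 'a \<Rightarrow> 'a gl \<times> 'a \<Rightarrow> 'a gl \<times> 'a"
  where "omni_bracket = (\<lambda>(\<xi>1, v1) (\<xi>2, v2). (gl_bracket \<xi>1 \<xi>2, gl_apply \<xi>1 v2))"

end

theory Submission
  imports Defs
begin

text \<open>
  A derivation of \<open>V[1]\<close> is the same thing as an endomorphism of \<open>V\<close>. It kills \<open>1\<close>, and it maps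
  \<open>V\<close> into \<open>V\<close>: if \<open>X v = w + s 1\<close> with \<open>v \<noteq> 0\<close>, then \<open>0 = X (v v) = 2 v (X v) = 2 s v\<close>, so \<open>s = 0\<close>.
  Conversely, every endomorphism extended by \<open>0\<close> on \<open>1\<close> satisfies the Leibniz rule.

  The identity of \<open>V\<close> corresponds to the Euler derivation \<open>E\<close>, which projects \<open>V[1]\<close> onto \<open>V\<close>.
  It controls all pairings through the identity \<open>\<langle>X, \<alpha>\<rangle> = X \<langle>E, \<alpha>\<rangle>\<close> (\<open>pairing_via_euler\<close>). So a
  differential that pairs to zero with \<open>E\<close> pairs to zero with every derivation, and
  \<open>(X, \<alpha>) \<mapsto> (X restricted to V, \<langle>E, \<alpha>\<rangle>)\<close> has exactly the kernel of the bilinear form as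
  its kernel. A preimage of \<open>(\<xi>, v)\<close> is given by the extension of \<open>\<xi>\<close> and by \<open>dv\<close>.

  It remains to pair the second component of the Courant bracket with \<open>E\<close>. Since \<open>E\<close> commutes with
  every derivation, \<open>\<langle>E, L_X \<alpha>\<rangle> = X \<langle>E, \<alpha>\<rangle>\<close>; and
  \<open>\<langle>E, d\<langle>X2, \<alpha>1\<rangle>\<rangle> = E X2 \<langle>E, \<alpha>1\<rangle> = X2 \<langle>E, \<alpha>1\<rangle>\<close>, which cancels the contribution of
  \<open>- L_X2 \<alpha>1\<close>. What is left is \<open>X1 \<langle>E, \<alpha>2\<rangle>\<close>, the second component of Weinstein's bracket.
\<close>

lemmas unitalization_ops =
  zero_unitalization_def plus_unitalization_def minus_unitalization_def
  scaleR_unitalization_def times_unitalization_def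

lemma unitalization_decomp:
  "a = Unitalization (vec_part a) 0 + of_real (scal_part a)"
  by (cases a) (simp add: of_real_def one_unitalization_def unitalization_ops)

lemma der_apply_vec: "der_apply X (Unitalization (vec_part a) 0) = der_apply X a"
  by (subst (2) unitalization_decomp[of a], subst der_add) simp

text \<open>The Leibniz rule for \<open>v v = 0\<close> says \<open>2 s v = 0\<close>, where \<open>s\<close> is the scalar part of \<open>X v\<close>. This
  gives \<open>s = 0\<close> unless \<open>v = 0\<close>, and then \<open>X v = 0\<close> anyway.\<close>

lemma scal_part_der: "scal_part (der_apply X a) = 0"
proof -
  define v where "v = Unitalization (vec_part a) 0"
  have "v * der_apply X v + v * der_apply X v = der_apply X (v * v)"
    by (rule der_mult[symmetric])
  also have "v * v = 0"
    by (simp add: v_def unitalization_ops)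
  also have "der_apply X 0 = 0"
    by simp
  finally have "scal_part (der_apply X v) *\<^sub>R vec_part a
      + scal_part (der_apply X v) *\<^sub>R vec_part a = 0"
    by (simp add: v_def unitalization_ops)
  then have "(scal_part (der_apply X v) + scal_part (der_apply X v)) *\<^sub>R vec_part a = 0"
    by (simp only: scaleR_add_left)
  moreover have "scal_part (der_apply X v) = 0" if "vec_part a = 0"
  proof -
    have "v = 0"
      using that by (simp add: v_def unitalization_ops)
    then have "der_apply X v = 0"
      by simp
    then show ?thesis
      by (simp add: zero_unitalization_def)
  qed
  ultimately have "scal_part (der_apply X v) = 0"
    by auto
  then show ?thesis
    by (simp add: v_def der_apply_vec)
qed

lemma vec_part_linear:
  "vec_part (a + b) = vec_part a + vec_part b"
  "vec_part (a - b) = vec_part a - vec_part b"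
  "vec_part (r *\<^sub>R a) = r *\<^sub>R vec_part a"
  by (simp_all add: unitalization_ops)

lemma unitalization_vec_linear:
  "Unitalization (u + v) 0 = Unitalization u 0 + Unitalization v 0"
  "Unitalization (r *\<^sub>R v) 0 = r *\<^sub>R Unitalization v 0"
  by (simp_all add: unitalization_ops)

lift_definition gl_of_der :: "'v::real_vector unitalization derivation \<Rightarrow> 'v gl"
  is "\<lambda>X v. vec_part (X (Unitalization v 0))"
  by (auto simp: linear_iff unitalization_vec_linear vec_part_linear)

lift_definition der_of_gl :: "'v::real_vector gl \<Rightarrow> 'v unitalization derivation"
  is "\<lambda>\<xi> a. Unitalization (\<xi> (vec_part a)) 0"
  by (auto simp: linear_iff unitalization_ops)

lemma vec_part_der: "vec_part (der_apply X a) = gl_apply (gl_of_der X) (vec_part a)"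
  by (simp add: gl_of_der.rep_eq der_apply_vec)

lemma gl_of_der_of_gl: "gl_of_der (der_of_gl \<xi>) = \<xi>"
  by transfer simp

lemma gl_of_der_eqD:
  assumes "gl_of_der X = gl_of_der Y"
  shows "X = Y"
proof -
  have "der_apply X a = der_apply Y a" for a
    using assms by (simp add: unitalization.expand scal_part_der vec_part_der)
  then show ?thesis
    by (simp add: der_apply_inject[symmetric] fun_eq_iff)
qed

lemma gl_of_der_bracket: "gl_of_der (der_bracket X Y) = gl_bracket (gl_of_der X) (gl_of_der Y)"
proof -
  have "gl_apply (gl_of_der (der_bracket X Y)) v
      = gl_apply (gl_bracket (gl_of_der X) (gl_of_der Y)) v" for v
    by (simp add: gl_of_der.rep_eq[of "der_bracket X Y"] der_bracket_apply vec_part_linear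
        vec_part_der gl_bracket.rep_eq)
  then show ?thesis
    by (simp add: gl_apply_inject[symmetric] fun_eq_iff)
qed

lemma gl_of_der_add: "gl_of_der (X + Y) = gl_of_der X + gl_of_der Y"
  by transfer (simp add: vec_part_linear)

lemma gl_of_der_scaleR: "gl_of_der (r *\<^sub>R X) = r *\<^sub>R gl_of_der X"
  by transfer (simp add: vec_part_linear)

lift_definition euler_der :: "'v::real_vector unitalization derivation"
  is "\<lambda>a. Unitalization (vec_part a) 0"
  by (auto simp: linear_iff unitalization_ops)

lemma der_bracket_euler: "der_bracket X euler_der = 0"
  by (rule gl_of_der_eqD)
    (simp add: gl_apply_inject[symmetric] gl_of_der.rep_eq der_bracket_apply zero_derivation.rep_eq
      euler_der.rep_eq der_apply_vec unitalization.expand scal_part_der unitalization_ops)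

text \<open>On a generator \<open>a db\<close> only the scalar part \<open>s\<close> of \<open>a\<close> matters, since \<open>X b\<close> lies in \<open>V\<close> and
  \<open>V V = 0\<close>. Hence \<open>\<langle>X, a db\<rangle> = s X b = X (s E b)\<close>.\<close>

lemma pairing_via_euler: "pairing X \<alpha> = der_apply X (pairing euler_der \<alpha>)"
proof (induction \<alpha> rule: kaehler_induct)
  case (gen a b)
  have "a * der_apply X b = scal_part a *\<^sub>R der_apply X b"
    by (simp add: times_unitalization_def scaleR_unitalization_def scal_part_der)
  moreover have "a * der_apply euler_der b = scal_part a *\<^sub>R Unitalization (vec_part b) 0"
    by (simp add: times_unitalization_def scaleR_unitalization_def euler_der.rep_eq)
  ultimately show ?case
    by (simp add: pairing_kscale_kd der_scaleR der_apply_vec)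
qed (simp add: pairing_add der_add)

text \<open>The vector in \<open>V\<close> that a differential \<open>\<Sum> a\<^sub>i db\<^sub>i\<close> determines: the sum of the vector parts
  of the \<open>b\<^sub>i\<close>, weighted by the scalar parts of the \<open>a\<^sub>i\<close>.\<close>

definition kaehler_vec :: "'v::real_vector unitalization kaehler \<Rightarrow> 'v"
  where "kaehler_vec \<alpha> = vec_part (pairing euler_der \<alpha>)"

lemma kaehler_vec_add: "kaehler_vec (\<alpha> + \<beta>) = kaehler_vec \<alpha> + kaehler_vec \<beta>"
  by (simp add: kaehler_vec_def pairing_add vec_part_linear)

lemma kaehler_vec_diff: "kaehler_vec (\<alpha> - \<beta>) = kaehler_vec \<alpha> - kaehler_vec \<beta>"
  by (simp add: kaehler_vec_def pairing_diff vec_part_linear)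

lemma kaehler_vec_scaleR: "kaehler_vec (r *\<^sub>R \<alpha>) = r *\<^sub>R kaehler_vec \<alpha>"
  by (simp add: kaehler_vec_def scaleR_kaehler_def pairing_kscale vec_part_linear
      flip: scaleR_conv_of_real)

lemma kaehler_vec_kd: "kaehler_vec (kd b) = vec_part b"
  using pairing_kscale_kd[of euler_der 1 b] by (simp add: kaehler_vec_def euler_der.rep_eq)

lemma vec_part_pairing: "vec_part (pairing X \<alpha>) = gl_apply (gl_of_der X) (kaehler_vec \<alpha>)"
  by (subst pairing_via_euler) (simp add: vec_part_der kaehler_vec_def)

lemma kaehler_vec_eq_0_iff: "kaehler_vec \<alpha> = 0 \<longleftrightarrow> (\<forall>X. pairing X \<alpha> = 0)"
proof
  assume "kaehler_vec \<alpha> = 0"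
  then have "vec_part (pairing euler_der \<alpha>) = 0"
    by (simp add: kaehler_vec_def)
  then have "der_apply X (pairing euler_der \<alpha>) = der_apply X 0" for X
    by (subst der_apply_vec[symmetric]) (simp add: zero_unitalization_def)
  then show "\<forall>X. pairing X \<alpha> = 0"
    by (subst pairing_via_euler) simp
qed (simp add: kaehler_vec_def zero_unitalization_def)

lemma kaehler_vec_lie_derivative:
  "kaehler_vec (lie_derivative X \<alpha>) = gl_apply (gl_of_der X) (kaehler_vec \<alpha>)"
  by (simp add: kaehler_vec_def pairing_lie_derivative der_bracket_euler vec_part_der)

text \<open>The kernel of the bilinear form is the kernel of the map to \<open>gl(V) \<oplus> V\<close>. One direction makes
  that map well defined on the quotient; the other makes it injective there.\<close>

lemma diff_in_courant_kernel_iff: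
  "(X, \<alpha>) - (Y, \<beta>) \<in> courant_kernel
    \<longleftrightarrow> gl_of_der X = gl_of_der Y \<and> kaehler_vec \<alpha> = kaehler_vec \<beta>"
  by (auto simp: courant_kernel_iff kaehler_vec_diff dest: gl_of_der_eqD
      simp flip: kaehler_vec_eq_0_iff)

lift_definition omni_of_eps :: "'v::real_vector unitalization eps \<Rightarrow> 'v gl \<times> 'v"
  is "\<lambda>(X, \<alpha>). (gl_of_der X, kaehler_vec \<alpha>)"
  by (auto simp only: split_paired_all diff_in_courant_kernel_iff prod.case)

lemma linear_omni_of_eps: "linear (omni_of_eps :: 'v::real_vector unitalization eps \<Rightarrow> _)"
proof (rule linearI)
  show "omni_of_eps (x + y) = omni_of_eps x + omni_of_eps y" for x y :: "'v unitalization eps"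
    by transfer (auto simp: gl_of_der_add kaehler_vec_add)
  show "omni_of_eps (r *\<^sub>R x) = r *\<^sub>R omni_of_eps x" for r and x :: "'v unitalization eps"
    by transfer (auto simp: gl_of_der_scaleR kaehler_vec_scaleR)
qed

lemma bij_omni_of_eps: "bij (omni_of_eps :: 'v::real_vector unitalization eps \<Rightarrow> _)"
proof (rule bijI)
  have "x = y" if "omni_of_eps x = omni_of_eps y" for x y :: "'v unitalization eps"
    using that
    by transfer (auto simp only: split_paired_all diff_in_courant_kernel_iff prod.case prod.inject)
  then show "inj (omni_of_eps :: 'v unitalization eps \<Rightarrow> _)"
    by (rule injI)
  have "omni_of_eps (abs_eps (der_of_gl \<xi>, kd (Unitalization v 0))) = (\<xi>, v)" for \<xi> and v :: 'v
    by (simp add: omni_of_eps.abs_eq gl_of_der_of_gl kaehler_vec_kd)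
  then show "surj (omni_of_eps :: 'v unitalization eps \<Rightarrow> _)"
    by (metis surj_def surj_pair)
qed

text \<open>For the vector component, the exact term \<open>d\<langle>X2, \<alpha>1\<rangle>\<close> and the term \<open>- L_X2 \<alpha>1\<close>
  contribute opposite values, which is why the result is not antisymmetric.\<close>

lemma omni_of_eps_bracket:
  "omni_of_eps (eps_bracket e1 e2) = omni_bracket (omni_of_eps e1) (omni_of_eps e2)"
  by transfer
    (auto simp: courant_bracket_def omni_bracket_def gl_of_der_bracket kaehler_vec_add
      kaehler_vec_diff kaehler_vec_lie_derivative kaehler_vec_kd vec_part_pairing)

theorem theorem1p4:
  assumes "\<exists>B :: 'v::real_vector set. finite B \<and> span B = UNIV"
  shows "\<exists>\<Phi> :: 'v unitalization eps \<Rightarrow> 'v gl \<times> 'v.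
           linear \<Phi> \<and> bij \<Phi> \<and>
           (\<forall>e1 e2. \<Phi> (eps_bracket e1 e2) = omni_bracket (\<Phi> e1) (\<Phi> e2))"
  using linear_omni_of_eps bij_omni_of_eps omni_of_eps_bracket by blast

end
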